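(* There is an absolute constant $c>0$ such that for all $n$, $k\ge 1$ and $\epsilon>0$, the sample complexity of the $k$-Colorable property satisfies \[ \mathcal{S}_{k\textsc{-Colorable}}(n,\epsilon) \le c\cdot\frac{k}{\epsilon}\ln^2\!\left(\frac1\epsilon\right), \] i.e. $\mathcal{S}_{k\textsc{-Colorable}}(n,\epsilon) = O\!\left(\frac{k}{\epsilon}\ln^2(\frac1\epsilon)\right)$.
   Context: Graphs are simple and undirected. The $k$-Colorable property is the set of all $k$-colorable graphs on $n$ vertices. A graph $G$ on $n$ vertices is $\epsilon$-far from a property $\Pi$ if at least $\epsilon n^2$ edges must be added to or removed from $G$ to obtain a graph with $\Pi$ (for $k$-colorability: every $k$-coloring of the vertices has at least $\epsilon n^2$ monochromatic edges). A canonical $\epsilon$-tester for $\Pi$ with sample cost $s$ is a bounded-error randomized algorithm that samples a set $S$ of $s$ vertices of an unknown graph $G$, examines only $G[S]$, and distinguishes the case that $G$ has $\Pi$ from the case that $G$ is $\epsilon$-far from $\Pi$; bounded error means there are absolute constants $\delta_1>\delta_2$ such that graphs with $\Pi$ are accepted with probability at least $\delta_1$ and graphs $\epsilon$-far from $\Pi$ with probability at most $\delta_2$. The sample complexity $\mathcal{S}_\Pi(n,\epsilon)$ is the minimum $s$ for which a canonical $\epsilon$-tester for $\Pi$ with sample cost $s$ exists. *)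

theory Defs
  imports "HOL-Library.Ramsey" "HOL-Probability.Probability"
begin

record ugraph =
  verts :: "nat set"
  edges :: "nat set set"

definition graphs_on :: "nat \<Rightarrow> ugraph set" where
  "graphs_on n = {G. verts G = {..<n} \<and> edges G \<subseteq> nsets {..<n} 2}"

definition induced :: "ugraph \<Rightarrow> nat set \<Rightarrow> ugraph" where
  "induced G S = \<lparr>verts = S, edges = {e \<in> edges G. e \<subseteq> S}\<rparr>"

definition colorable :: "nat \<Rightarrow> ugraph \<Rightarrow> bool" where
  "colorable k G \<longleftrightarrow>
     (\<exists>f. f \<in> verts G \<rightarrow> {..<k} \<and> (\<forall>u v. {u, v} \<in> edges G \<longrightarrow> f u \<noteq> f v))"

text \<open>A graph property assigns to each \<open>n\<close> the set of graphs on \<open>n\<close> vertices having it.\<close>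

definition k_Colorable :: "nat \<Rightarrow> nat \<Rightarrow> ugraph set" where
  "k_Colorable k n = {G \<in> graphs_on n. colorable k G}"

definition eps_far :: "(nat \<Rightarrow> ugraph set) \<Rightarrow> nat \<Rightarrow> real \<Rightarrow> ugraph \<Rightarrow> bool" where
  "eps_far P n \<epsilon> G \<longleftrightarrow>
     (\<forall>H \<in> P n. real (card (sym_diff (edges G) (edges H))) \<ge> \<epsilon> * (real n)\<^sup>2)"

text \<open>The decision procedure \<open>A\<close> has its own randomness and receives nothing but the induced
  subgraph on a uniformly random set of \<open>s\<close> vertices. The underlying
  \<^const>\<open>pmf_of_set\<close> is meaningful only for \<open>s \<le> n\<close>.\<close>

definition accept_prob :: "(ugraph \<Rightarrow> bool pmf) \<Rightarrow> nat \<Rightarrow> nat \<Rightarrow> ugraph \<Rightarrow> real" where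
  "accept_prob A n s G =
     pmf (bind_pmf (pmf_of_set (nsets {..<n} s)) (\<lambda>S. A (induced G S))) True"

definition canonical_tester ::
  "real \<Rightarrow> real \<Rightarrow> (nat \<Rightarrow> ugraph set) \<Rightarrow> nat \<Rightarrow> real \<Rightarrow> nat \<Rightarrow> (ugraph \<Rightarrow> bool pmf) \<Rightarrow> bool" where
  "canonical_tester \<delta>\<^sub>1 \<delta>\<^sub>2 P n \<epsilon> s A \<longleftrightarrow>
     s \<le> n \<and>
     (\<forall>G \<in> graphs_on n.
        (G \<in> P n \<longrightarrow> accept_prob A n s G \<ge> \<delta>\<^sub>1) \<and>
        (eps_far P n \<epsilon> G \<longrightarrow> accept_prob A n s G \<le> \<delta>\<^sub>2))"

definition sample_complexity ::
  "real \<Rightarrow> real \<Rightarrow> (nat \<Rightarrow> ugraph set) \<Rightarrow> nat \<Rightarrow> real \<Rightarrow> nat" where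
  "sample_complexity \<delta>\<^sub>1 \<delta>\<^sub>2 P n \<epsilon> = (LEAST s. \<exists>A. canonical_tester \<delta>\<^sub>1 \<delta>\<^sub>2 P n \<epsilon> s A)"

end

theory Submission imports Defs begin

text \<open>
  Graph containers. If a sample \<open>S\<close> is \<open>k\<close>-colourable, each colour class is an independent set,
  and repeatedly picking its vertex of largest degree inside the current container (discarding that
  vertex, its neighbours and all vertices of larger degree) yields \<open>t\<close> fingerprint vertices
  and a container \<open>C\<^sub>i\<^sup>t\<close>, of maximum degree at most \<open>n / (t + 1)\<close>, for the rest of the class.
  If \<open>G\<close> is far from \<open>k\<close>-colourable, then for some \<open>t = O(1/\<epsilon>)\<close> the union of the
  \<open>k\<close> containers misses \<open>\<Omega>(t \<epsilon> n / ln (1/\<epsilon>))\<close> vertices: otherwise colour every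
  vertex by a container it survives in longest, and charge each monochromatic edge to its endpoint
  that is lost first; a harmonic sum bounds the number of these edges by less than \<open>\<epsilon> n\<^sup>2\<close>.
  There are only \<open>s\<^sup>k\<^sup>t\<close> fingerprints inside \<open>S\<close>, and for each of them the rest
  of \<open>S\<close> avoids the missed vertices with probability \<open>exp (- \<Omega>(s t \<epsilon> / ln (1/\<epsilon>)))\<close>,
  so a union bound over fingerprints and \<open>t\<close> suffices once \<open>s\<close> is of order
  \<open>(k/\<epsilon>) ln\<^sup>2 (1/\<epsilon>)\<close>.
\<close>

section \<open>Containers and fingerprints of independent sets\<close>

definition nbrs :: "ugraph \<Rightarrow> nat set \<Rightarrow> nat \<Rightarrow> nat set" where
  "nbrs G C v = {u \<in> C. {u, v} \<in> edges G}"

text \<open>The default \<open>{}\<close> keeps the result inside \<open>C\<close> for every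
  \<open>v\<close> and makes the degree bounds vacuous when \<open>v\<close> lies outside
  \<open>C\<close>. Vertices whose degree ties with that of \<open>v\<close> survive.\<close>

definition shrink :: "ugraph \<Rightarrow> nat set \<Rightarrow> nat \<Rightarrow> nat set" where
  "shrink G C v =
     (if v \<in> C
      then {u \<in> C. u \<noteq> v \<and> {u, v} \<notin> edges G \<and> card (nbrs G C u) \<le> card (nbrs G C v)}
      else {})"

primrec container :: "ugraph \<Rightarrow> (nat \<Rightarrow> nat) \<Rightarrow> nat \<Rightarrow> nat set" where
  "container G x 0 = verts G"
| "container G x (Suc t) = shrink G (container G x t) (x t)"

lemma edge_in_graphs_on:
  assumes "G \<in> graphs_on n" "{u, v} \<in> edges G"
  shows "u < n" "v < n" "u \<noteq> v"
proof -
  have "{u, v} \<in> nsets {..<n} 2"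
    using assms unfolding graphs_on_def by blast
  then show "u < n" "v < n" "u \<noteq> v"
    by (auto simp: nsets_def card_insert_if split: if_splits)
qed

lemma finite_graphs_on_verts: "G \<in> graphs_on n \<Longrightarrow> finite (verts G)"
  by (auto simp: graphs_on_def)

lemma shrink_subset: "shrink G C v \<subseteq> C"
  by (auto simp: shrink_def)

lemma container_antimono: "s \<le> t \<Longrightarrow> container G x t \<subseteq> container G x s"
  by (rule lift_Suc_antimono_le[of "container G x"]) (simp_all add: shrink_subset)

lemma container_subset_verts: "container G x t \<subseteq> verts G"
  using container_antimono[of 0 t G x] by simp

lemma finite_container: "G \<in> graphs_on n \<Longrightarrow> finite (container G x t)"
  by (rule finite_subset[OF container_subset_verts finite_graphs_on_verts])

lemma container_cong: "(\<And>j. j < t \<Longrightarrow> x j = y j) \<Longrightarrow> container G x t = container G y t"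
  by (induction t) auto

text \<open>Each step discards the neighbours of the chosen vertex. There are at least as many of
  them as the degree of any survivor, and degrees only drop as the container shrinks. So
  \<open>t\<close> steps have removed at least \<open>t\<close> times the current degree of
  \<open>u\<close>.\<close>

lemma card_container_add_degree_le:
  assumes G: "G \<in> graphs_on n"
  shows "u \<in> container G x t \<Longrightarrow> card (container G x t) + t * card (nbrs G (container G x t) u) \<le> n"
proof (induction t arbitrary: u)
  case 0
  then show ?case using G by (simp add: graphs_on_def)
next
  case (Suc t)
  define C where "C = container G x t"
  define v where "v = x t"
  define D where "D = shrink G C v"
  have finC: "finite C"
    unfolding C_def using G by (rule finite_container)
  have uD: "u \<in> D" using Suc.prems by (simp add: D_def C_def v_def)
  then have v: "v \<in> C" and le: "card (nbrs G C u) \<le> card (nbrs G C v)"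
    by (auto simp: D_def shrink_def split: if_splits)
  have IH: "card C + t * card (nbrs G C v) \<le> n"
    using Suc.IH v by (simp add: C_def)
  have sub: "nbrs G C v \<subseteq> C" "D \<subseteq> C" "D \<inter> nbrs G C v = {}"
    by (auto simp: D_def shrink_def nbrs_def)
  have "card D + card (nbrs G C v) = card (D \<union> nbrs G C v)"
    using sub finC by (simp add: card_Un_disjoint finite_subset)
  also have "\<dots> \<le> card C" using sub finC by (intro card_mono) auto
  finally have 1: "card D + card (nbrs G C v) \<le> card C" .
  have "card (nbrs G D u) \<le> card (nbrs G C u)"
    using sub finC by (intro card_mono) (auto simp: nbrs_def)
  then have "Suc t * card (nbrs G D u) \<le> Suc t * card (nbrs G C v)"
    using le by (intro mult_le_mono2) simp
  then show ?case using 1 IH by (simp add: D_def C_def v_def)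
qed

text \<open>The remaining container still includes the neighbours of \<open>u\<close>, which turns
  the factor \<open>t\<close> into \<open>Suc t\<close> and makes the bound meaningful at
  \<open>t = 0\<close>.\<close>

lemma Suc_mult_degree_container_le:
  assumes G: "G \<in> graphs_on n" and u: "u \<in> container G x t"
  shows "Suc t * card (nbrs G (container G x t) u) \<le> n"
proof -
  have "finite (container G x t)"
    using G by (rule finite_container)
  then have "card (nbrs G (container G x t) u) \<le> card (container G x t)"
    by (intro card_mono) (auto simp: nbrs_def)
  then show ?thesis using card_container_add_degree_le[OF assms] by simp
qed

text \<open>A vertex of \<open>I \<inter> C\<close> with largest degree in \<open>C\<close> works:
  no vertex of \<open>I\<close> is adjacent to it or exceeds its degree. If \<open>I\<close> has
  left \<open>C\<close>, any vertex of \<open>S\<close> will do, hence \<open>v\<close> is sought in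
  \<open>S\<close> and not in \<open>I\<close>.\<close>

lemma shrink_retains_independent:
  assumes "finite S" "S \<noteq> {}" "I \<subseteq> S" and indep: "\<And>u v. u \<in> I \<Longrightarrow> v \<in> I \<Longrightarrow> {u, v} \<notin> edges G"
  shows "\<exists>v\<in>S. I \<inter> C - {v} \<subseteq> shrink G C v"
proof (cases "I \<inter> C = {}")
  case True
  then show ?thesis using assms(2) by auto
next
  case False
  have "finite (I \<inter> C)" using assms finite_subset by blast
  have "\<exists>v. v \<in> I \<inter> C \<and> (\<forall>u. u \<in> I \<inter> C \<longrightarrow> card (nbrs G C u) \<le> card (nbrs G C v))"
  proof -
    let ?D = "(\<lambda>v. card (nbrs G C v)) ` (I \<inter> C)"
    have "Max ?D \<in> ?D" using False \<open>finite (I \<inter> C)\<close> by (intro Max_in) auto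
    then obtain v where "v \<in> I \<inter> C" "card (nbrs G C v) = Max ?D" by auto
    then show ?thesis using \<open>finite (I \<inter> C)\<close> by (metis Max_ge finite_imageI imageI)
  qed
  then obtain v where v: "v \<in> I \<inter> C" "\<And>u. u \<in> I \<inter> C \<Longrightarrow> card (nbrs G C u) \<le> card (nbrs G C v)"
    by blast
  then have "I \<inter> C - {v} \<subseteq> shrink G C v" using indep by (auto simp: shrink_def)
  then show ?thesis using v assms(3) by blast
qed

lemma fingerprint_exists:
  assumes "finite S" "S \<noteq> {}" "I \<subseteq> S" "I \<subseteq> verts G"
    and indep: "\<And>u v. u \<in> I \<Longrightarrow> v \<in> I \<Longrightarrow> {u, v} \<notin> edges G"
  shows "\<exists>x. range x \<subseteq> S \<and> (\<forall>t. I - x ` {..<t} \<subseteq> container G x t)"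
proof -
  \<comment> \<open>The choice depends on the current container alone, so iterating it gives one
    infinite sequence that serves all \<open>t\<close> at once.\<close>
  obtain p where p: "\<And>C. p C \<in> S" "\<And>C. I \<inter> C - {p C} \<subseteq> shrink G C (p C)"
    using shrink_retains_independent[OF assms(1,2,3) indep] by metis
  define C where "C = (\<lambda>t. ((\<lambda>C. shrink G C (p C)) ^^ t) (verts G))"
  define x where "x = (\<lambda>t. p (C t))"
  have C: "container G x t = C t" for t
    by (induction t) (auto simp: C_def x_def)
  have "I - x ` {..<t} \<subseteq> container G x t" for t
  proof (induction t)
    case 0
    then show ?case using assms(4) by auto
  next
    case (Suc t)
    have "I - x ` {..<Suc t} \<subseteq> I \<inter> container G x t - {x t}"
      using Suc by (auto simp: lessThan_Suc)
    also have "\<dots> \<subseteq> container G x (Suc t)"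
      using p(2)[of "C t"] C[of t] by (simp add: x_def)
    finally show ?case .
  qed
  then show ?thesis using p(1) by (intro exI[of _ x]) (auto simp: x_def)
qed

text \<open>Colour classes of the sample are independent, so each has its own fingerprint sequence.
  The pair \<open>(i, j)\<close> addresses the \<open>j\<close>-th vertex chosen for colour
  \<open>i\<close>.\<close>

lemma colorable_fingerprints_exist:
  assumes G: "G \<in> graphs_on n" and S: "S \<subseteq> {..<n}" "S \<noteq> {}" and col: "colorable k (induced G S)"
  shows "\<exists>x :: nat \<times> nat \<Rightarrow> nat. range x \<subseteq> S \<and>
    (\<forall>t. S \<subseteq> x ` ({..<k} \<times> {..<t}) \<union> (\<Union>i<k. container G (\<lambda>j. x (i, j)) t))"
proof -
  obtain f where f: "f \<in> S \<rightarrow> {..<k}" "\<And>u v. {u, v} \<in> edges G \<Longrightarrow> {u, v} \<subseteq> S \<Longrightarrow> f u \<noteq> f v"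
    using col unfolding colorable_def induced_def by (auto simp del: insert_subset)
  have finS: "finite S" using S finite_subset by blast
  have "\<exists>x. range x \<subseteq> S \<and> (\<forall>t. {v \<in> S. f v = i} - x ` {..<t} \<subseteq> container G x t)" for i
  proof (rule fingerprint_exists[OF finS S(2)])
    show "{v \<in> S. f v = i} \<subseteq> verts G" using G S(1) by (auto simp: graphs_on_def)
    show "{u, v} \<notin> edges G" if "u \<in> {v \<in> S. f v = i}" "v \<in> {v \<in> S. f v = i}" for u v
      using f(2)[of u v] that by auto
  qed auto
  then obtain x where x: "\<And>i. range (x i) \<subseteq> S"
      "\<And>i t. {v \<in> S. f v = i} - x i ` {..<t} \<subseteq> container G (x i) t"
    by metis
  have "S \<subseteq> (\<lambda>(i, j). x i j) ` ({..<k} \<times> {..<t}) \<union> (\<Union>i<k. container G (x i) t)" for t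
  proof
    fix v assume v: "v \<in> S"
    have "f v < k" using f(1) v by auto
    moreover have "v \<in> x (f v) ` {..<t} \<or> v \<in> container G (x (f v)) t"
      using x(2)[of "f v" t] v by auto
    ultimately show "v \<in> (\<lambda>(i, j). x i j) ` ({..<k} \<times> {..<t}) \<union> (\<Union>i<k. container G (x i) t)"
      by (auto intro: rev_image_eqI[of "(f v, _)"])
  qed
  moreover have "range (\<lambda>(i, j). x i j) \<subseteq> S" using x(1) by (simp add: image_subset_iff)
  ultimately show ?thesis by (intro exI[of _ "\<lambda>(i, j). x i j"]) simp
qed

section \<open>Far graphs: some union of containers misses many vertices\<close>

lemma eps_far_imp_many_monochromatic:
  assumes G: "G \<in> graphs_on n" and far: "eps_far (k_Colorable k) n \<epsilon> G" and f: "f \<in> {..<n} \<rightarrow> {..<k}"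
  shows "\<epsilon> * (real n)\<^sup>2 \<le> real (card {e \<in> edges G. \<exists>u v. e = {u, v} \<and> f u = f v})"
proof -
  define M where "M = {e \<in> edges G. \<exists>u v. e = {u, v} \<and> f u = f v}"
  \<comment> \<open>Deleting exactly the monochromatic edges makes \<open>f\<close> a proper
    colouring, so their number bounds the edit distance from above.\<close>
  define H where "H = \<lparr>verts = {..<n}, edges = edges G - M\<rparr>"
  have "H \<in> graphs_on n" using G by (auto simp: H_def graphs_on_def)
  moreover have "colorable k H"
    unfolding colorable_def using f by (intro exI[of _ f]) (auto simp: H_def M_def)
  ultimately have "\<epsilon> * (real n)\<^sup>2 \<le> real (card (sym_diff (edges G) (edges H)))"
    using far by (auto simp: eps_far_def k_Colorable_def)
  also have "sym_diff (edges G) (edges H) = M" by (auto simp: H_def M_def)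
  finally show ?thesis by (simp add: M_def)
qed

text \<open>Telescoping of 1/t - 1/(t+1) = 1/(t(t+1)) over a < t \<le> T. Keeping the full range
  \<open>{1..T}\<close> with a condition allows the sum to be swapped with a sum over
  vertices.\<close>

lemma harmonic_telescope:
  fixes a T :: nat
  assumes "a \<le> T"
  shows "1 / real (Suc a) = 1 / real (Suc T) + (\<Sum>t\<in>{1..T}. if a < t then 1 / (real t * real (Suc t)) else 0)"
  using assms
proof (induction T rule: dec_induct)
  case base
  have "(\<Sum>t\<in>{1..a}. if a < t then 1 / (real t * real (Suc t)) else 0) = 0"
    by (intro sum.neutral) auto
  then show ?case by simp
next
  case (step N)
  have "1 / real (Suc N) = 1 / real (Suc (Suc N)) + 1 / (real (Suc N) * real (Suc (Suc N)))"
    by (simp add: divide_simps)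
  then show ?case using step by simp
qed

lemma sum_inverse_Suc_le_ln: "(\<Sum>t\<in>{1..T}. 1 / real (Suc t)) \<le> ln (real (Suc T))"
proof (induction T)
  case (Suc T)
  have "1 / real (Suc (Suc T)) \<le> ln (real (Suc (Suc T))) - ln (real (Suc T))"
  proof -
    have "ln (real (Suc T) / real (Suc (Suc T))) \<le> real (Suc T) / real (Suc (Suc T)) - 1"
      by (intro ln_le_minus_one) auto
    then show ?thesis by (simp add: ln_div field_simps)
  qed
  then show ?case using Suc by simp
qed simp

lemma far_imp_containers_miss_many:
  assumes G: "G \<in> graphs_on n" and n: "n \<ge> 1" and far: "eps_far (k_Colorable k) n \<epsilon> G"
    and k: "k \<ge> 1" and T: "1 / real (Suc T) < \<epsilon> / 2" and \<gamma>: "\<gamma> * ln (real (Suc T)) \<le> \<epsilon> / 2" "0 \<le> \<gamma>"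
  shows "\<exists>t\<in>{1..T}. \<gamma> * real t * real n \<le> real (card ({..<n} - (\<Union>i<k. container G (x i) t)))"
proof (rule ccontr)
  define U where "U = (\<lambda>t. \<Union>i<k. container G (x i) t)"
  assume "\<not> ?thesis"
  then have small: "real (card ({..<n} - U t)) \<le> \<gamma> * real t * real n" if "t \<in> {1..T}" for t
    using that by (force simp: U_def)
  have U0: "U 0 = {..<n}" using G k by (force simp: U_def graphs_on_def)
  \<comment> \<open>The last index up to \<open>T\<close> at which some container still holds
    \<open>v\<close>. Index 0 always qualifies because \<open>U 0\<close> is the whole vertex
    set.\<close>
  define \<tau> where "\<tau> = (\<lambda>v. Max {t. t \<le> T \<and> v \<in> U t})"
  have \<tau>: "\<tau> v \<le> T" "v \<in> U (\<tau> v)" if "v < n" for v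
  proof -
    have "\<tau> v \<in> {t. t \<le> T \<and> v \<in> U t}"
      unfolding \<tau>_def using that U0 by (intro Max_in) auto
    then show "\<tau> v \<le> T" "v \<in> U (\<tau> v)" by auto
  qed
  have \<tau>_less: "v \<notin> U t" if "t \<le> T" "\<tau> v < t" for v t
    using that Max_ge[of "{t. t \<le> T \<and> v \<in> U t}" t] by (fastforce simp: \<tau>_def)
  have "\<exists>i. v < n \<longrightarrow> i < k \<and> v \<in> container G (x i) (\<tau> v)" for v
    using \<tau>(2)[of v] by (auto simp: U_def)
  then obtain f where f: "\<And>v. v < n \<Longrightarrow> f v < k" "\<And>v. v < n \<Longrightarrow> v \<in> container G (x (f v)) (\<tau> v)"
    by metis
  define N where "N = (\<lambda>v. nbrs G (container G (x (f v)) (\<tau> v)) v)"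
  have finN: "finite (N v)" for v
    using finite_container[OF G] by (simp add: N_def nbrs_def)
  have cardN: "real (card (N v)) \<le> real n * (1 / real (Suc (\<tau> v)))" if "v < n" for v
  proof -
    have "Suc (\<tau> v) * card (N v) \<le> n"
      unfolding N_def using Suc_mult_degree_container_le[OF G f(2)[OF that]] .
    then have "real (Suc (\<tau> v)) * real (card (N v)) \<le> real n"
      by (metis of_nat_le_iff of_nat_mult)
    then show ?thesis by (simp add: field_simps)
  qed
  define M where "M = {e \<in> edges G. \<exists>u v. e = {u, v} \<and> f u = f v}"
  have M_sub: "M \<subseteq> (\<Union>v<n. (\<lambda>u. {u, v}) ` N v)"
  proof
    fix e assume "e \<in> M"
    then obtain u v where e: "e = {u, v}" "{u, v} \<in> edges G" "f u = f v" by (auto simp: M_def)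
    \<comment> \<open>An edge is charged to its endpoint \<open>v\<close> with the smaller
      \<open>\<tau>\<close>. The other endpoint has the same colour and survives at least as long,
      so it still lies in the container of \<open>v\<close> at time \<open>\<tau> v\<close>.\<close>
    have *: "e \<in> (\<Union>v<n. (\<lambda>u. {u, v}) ` N v)"
      if "e = {u, v}" "{u, v} \<in> edges G" "f u = f v" "\<tau> v \<le> \<tau> u" for u v
    proof -
      have "u < n" "v < n" using edge_in_graphs_on[OF G that(2)] by auto
      then have "u \<in> container G (x (f v)) (\<tau> v)"
        using f(2)[of u] container_antimono[OF that(4)] that(3) by auto
      then have "u \<in> N v" using that by (simp add: N_def nbrs_def)
      then show ?thesis using that \<open>v < n\<close> by blast
    qed
    show "e \<in> (\<Union>v<n. (\<lambda>u. {u, v}) ` N v)"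
      using *[of u v] *[of v u] e by (cases "\<tau> v \<le> \<tau> u") (auto simp: insert_commute)
  qed
  have far_M: "\<epsilon> * (real n)\<^sup>2 \<le> real (card M)"
    unfolding M_def using f(1) by (intro eps_far_imp_many_monochromatic[OF G far]) auto
  have "card M \<le> card (\<Union>v<n. (\<lambda>u. {u, v}) ` N v)"
    using M_sub finN by (intro card_mono) auto
  also have "\<dots> \<le> (\<Sum>v<n. card ((\<lambda>u. {u, v}) ` N v))" by (rule card_UN_le) simp
  also have "\<dots> \<le> (\<Sum>v<n. card (N v))" using finN by (intro sum_mono card_image_le)
  finally have "real (card M) \<le> (\<Sum>v<n. real (card (N v)))"
    by (metis of_nat_le_iff of_nat_sum)
  also have "\<dots> \<le> (\<Sum>v<n. real n * (1 / real (Suc (\<tau> v))))"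
    using cardN by (intro sum_mono) auto
  also have "\<dots> = real n * (\<Sum>v<n. 1 / real (Suc (\<tau> v)))" by (simp only: sum_distrib_left)
  finally have M_le: "real (card M) \<le> real n * (\<Sum>v<n. 1 / real (Suc (\<tau> v)))" .
  \<comment> \<open>Summation by layers: the sum over vertices becomes a sum over \<open>t\<close>,
    weighted by the number of vertices already lost before \<open>t\<close>.\<close>
  have "(\<Sum>v<n. 1 / real (Suc (\<tau> v))) =
      (\<Sum>v<n. 1 / real (Suc T) + (\<Sum>t\<in>{1..T}. if \<tau> v < t then 1 / (real t * real (Suc t)) else 0))"
    using \<tau>(1) by (intro sum.cong refl harmonic_telescope) auto
  also have "\<dots> = real n / real (Suc T) +
      (\<Sum>t\<in>{1..T}. \<Sum>v<n. if \<tau> v < t then 1 / (real t * real (Suc t)) else 0)"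
    by (subst sum.swap) (simp add: sum.distrib)
  also have "(\<Sum>t\<in>{1..T}. \<Sum>v<n. if \<tau> v < t then 1 / (real t * real (Suc t)) else 0) \<le>
      (\<Sum>t\<in>{1..T}. \<gamma> * real n * (1 / real (Suc t)))"
  proof (intro sum_mono)
    fix t assume t: "t \<in> {1..T}"
    have "(\<Sum>v<n. if \<tau> v < t then 1 / (real t * real (Suc t)) else 0) =
        (\<Sum>v\<in>{v. v < n \<and> \<tau> v < t}. 1 / (real t * real (Suc t)))"
      by (simp add: sum.If_cases Int_def)
    also have "\<dots> = real (card {v. v < n \<and> \<tau> v < t}) * (1 / (real t * real (Suc t)))" by simp
    \<comment> \<open>The factor \<open>t\<close> in the number of lost vertices cancels against
      1/(t(t+1)), leaving a harmonic term.\<close>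
    also have "\<dots> \<le> (\<gamma> * real t * real n) * (1 / (real t * real (Suc t)))"
    proof (rule mult_right_mono)
      have "card {v. v < n \<and> \<tau> v < t} \<le> card ({..<n} - U t)"
        using \<tau>_less t by (intro card_mono) auto
      then show "real (card {v. v < n \<and> \<tau> v < t}) \<le> \<gamma> * real t * real n"
        using small[OF t] by linarith
    qed auto
    also have "\<dots> = \<gamma> * real n * (1 / real (Suc t))" using t by simp
    finally show "(\<Sum>v<n. if \<tau> v < t then 1 / (real t * real (Suc t)) else 0) \<le> \<gamma> * real n * (1 / real (Suc t))" .
  qed
  also have "(\<Sum>t\<in>{1..T}. \<gamma> * real n * (1 / real (Suc t))) \<le> \<gamma> * real n * ln (real (Suc T))"
    unfolding sum_distrib_left[symmetric]
    using \<gamma>(2) by (intro mult_left_mono sum_inverse_Suc_le_ln) auto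
  also have "real n / real (Suc T) + \<gamma> * real n * ln (real (Suc T)) =
      real n * (1 / real (Suc T) + \<gamma> * ln (real (Suc T)))" by (simp add: algebra_simps)
  \<comment> \<open>One half of \<epsilon> pays for vertices that survive to the end, the other half
    for the harmonic sum.\<close>
  also have "\<dots> < real n * \<epsilon>"
    using n T \<gamma>(1) by (intro mult_strict_left_mono) auto
  finally have "real n * (\<Sum>v<n. 1 / real (Suc (\<tau> v))) < real n * (real n * \<epsilon>)"
    using n by (intro mult_strict_left_mono) auto
  with M_le far_M show False by (simp add: power2_eq_square mult.commute mult.left_commute)
qed

section \<open>Counting the samples compatible with a fingerprint\<close>

lemma binomial_le_power_mult:
  fixes p :: real
  assumes "0 \<le> p" "p \<le> 1" "real m \<le> p * real N"
  shows "real (m choose r) \<le> p ^ r * real (N choose r)"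
\<comment> \<open>The quotient of the two binomials is the product of the factors (m - j)/(N - j)
  for j < r, and each is at most \<open>p\<close> because p \<le> 1.\<close>
proof (induction r)
  case (Suc r)
  show ?case
  proof (cases "Suc r \<le> m")
    case True
    have "p * real N \<le> real N" using assms(1,2) by (intro mult_left_le_one_le) auto
    then have "real m \<le> real N" using assms(3) by linarith
    have rec: "real (Suc r) * real (a choose Suc r) = real (a choose r) * (real a - real r)"
      if "r \<le> a" for a
    proof -
      have "Suc r * (a choose Suc r) = (a - r) * (a choose r)"
        using binomial_absorption[of r a] binomial_absorb_comp[of a r] by simp
      then have "real (Suc r * (a choose Suc r)) = real ((a - r) * (a choose r))" by simp
      then show ?thesis using that by (simp only: of_nat_mult of_nat_diff mult.commute)
    qed
    have "real (Suc r) * real (m choose Suc r) = real (m choose r) * (real m - real r)"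
      using rec True by simp
    also have "\<dots> \<le> (p ^ r * real (N choose r)) * (p * (real N - real r))"
    proof (intro mult_mono Suc.IH)
      have "p * real r \<le> real r" using assms by (simp add: mult_left_le_one_le)
      then show "real m - real r \<le> p * (real N - real r)" using assms(3) by (simp add: algebra_simps)
    qed (use True assms in auto)
    also have "\<dots> = p ^ Suc r * (real (N choose r) * (real N - real r))" by simp
    also have "\<dots> = p ^ Suc r * (real (Suc r) * real (N choose Suc r))"
      using rec[of N] True \<open>real m \<le> real N\<close> by simp
    finally have "real (Suc r) * real (m choose Suc r) \<le> real (Suc r) * (p ^ Suc r * real (N choose Suc r))"
      by (simp only: mult.left_commute)
    then show ?thesis by (rule mult_left_le_imp_le) simp
  next
    case False
    then have "real (m choose Suc r) = 0" by simp
    then show ?thesis using assms(1) by (simp only: mult_nonneg_nonneg zero_le_power of_nat_0_le_iff)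
  qed
qed simp

text \<open>Such a set is determined by its part outside \<open>F\<close>. The sets \<open>F\<close>
  and \<open>C\<close> may overlap; \<open>C = {..<n}\<close> yields the count of all samples that
  contain \<open>F\<close>.\<close>

lemma card_nsets_containing:
  assumes "finite F" "finite C" "card F \<le> s"
  shows "card {S \<in> nsets (F \<union> C) s. F \<subseteq> S} = card (C - F) choose (s - card F)"
proof -
  have "bij_betw (\<lambda>S. S - F) {S \<in> nsets (F \<union> C) s. F \<subseteq> S} (nsets (C - F) (s - card F))"
  proof (rule bij_betw_byWitness[where f' = "\<lambda>S. S \<union> F"])
    show "(\<lambda>S. S - F) ` {S \<in> nsets (F \<union> C) s. F \<subseteq> S} \<subseteq> nsets (C - F) (s - card F)"
      using assms(1) by (auto simp: nsets_def card_Diff_subset)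
    show "(\<lambda>S. S \<union> F) ` nsets (C - F) (s - card F) \<subseteq> {S \<in> nsets (F \<union> C) s. F \<subseteq> S}"
    proof clarify
      fix S assume "S \<in> nsets (C - F) (s - card F)"
      then have S: "S \<subseteq> C - F" "finite S" "card S = s - card F" by (auto simp: nsets_def)
      then have "card (S \<union> F) = s" using assms by (subst card_Un_disjoint) auto
      then show "S \<union> F \<in> nsets (F \<union> C) s \<and> F \<subseteq> S \<union> F" using S assms by (auto simp: nsets_def)
    qed
  qed (auto simp: nsets_def)
  then show ?thesis using bij_betw_same_card by fastforce
qed

text \<open>Given \<open>F \<subseteq> S\<close>, the other s - |F| \<ge> s/2 vertices form a
  uniform subset of the complement of \<open>F\<close>, and all must fall into \<open>C\<close>. The
  4 in the exponent combines this 1/2 with the loss from \<open>g\<close> to \<open>g / 2\<close> in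
  the density.\<close>

lemma card_nsets_between_le:
  fixes g :: real
  assumes F: "F \<subseteq> {..<n}" "2 * card F \<le> s" "real (card F) \<le> g / 2 * real n"
    and C: "C \<subseteq> {..<n}" "g * real n \<le> real (card ({..<n} - C))" and g: "0 \<le> g" and n: "n \<ge> 1"
  shows "real (card {S \<in> nsets {..<n} s. F \<subseteq> S \<and> S \<subseteq> F \<union> C})
    \<le> exp (- g * real s / 4) * real (card {S \<in> nsets {..<n} s. F \<subseteq> S})"
proof -
  define q where "q = card F"
  define r where "r = s - q"
  have fin: "finite F" "finite C" using F(1) C(1) by (auto intro: finite_subset)
  have q_le: "q \<le> n" using card_mono[OF _ F(1)] by (simp add: q_def)
  have cC: "real (card ({..<n} - C)) = real n - real (card C)" "card C \<le> n"
    using C(1) fin card_mono[OF _ C(1)] by (auto simp: card_Diff_subset)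
  have "g * real n \<le> 1 * real n" using C(2) cC by linarith
  then have g1: "g \<le> 1" using n by (simp add: mult_le_cancel_right)
  have "{S \<in> nsets {..<n} s. F \<subseteq> S \<and> S \<subseteq> F \<union> C} = {S \<in> nsets (F \<union> C) s. F \<subseteq> S}"
    using F(1) C(1) by (auto simp: nsets_def)
  then have lhs: "card {S \<in> nsets {..<n} s. F \<subseteq> S \<and> S \<subseteq> F \<union> C} = card (C - F) choose r"
    using card_nsets_containing[OF fin] F(2) by (simp add: q_def r_def)
  have "F \<union> {..<n} = {..<n}" using F(1) by auto
  then have rhs: "card {S \<in> nsets {..<n} s. F \<subseteq> S} = (n - q) choose r"
    using card_nsets_containing[OF fin(1), of "{..<n}" s] F fin
    by (simp add: q_def r_def card_Diff_subset)
  have "real (card (C - F)) \<le> real (card C)" using fin by (simp add: card_mono)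
  also have "\<dots> \<le> (1 - g) * real n" using C(2) cC by (simp add: algebra_simps)
  \<comment> \<open>Removing \<open>F\<close> costs at most g n / 2 vertices of the ground set, so
    half of the density gap \<open>g\<close> remains.\<close>
  also have "\<dots> \<le> (1 - g / 2) * real (n - q)"
  proof -
    have "0 \<le> g * real q" using g by simp
    moreover have "real q \<le> g / 2 * real n" using F(3) by (simp add: q_def)
    ultimately show ?thesis using q_le by (simp add: of_nat_diff algebra_simps diff_divide_distrib)
  qed
  finally have "real (card (C - F)) \<le> (1 - g / 2) * real (n - q)" .
  then have "real (card (C - F) choose r) \<le> (1 - g / 2) ^ r * real ((n - q) choose r)"
    using g g1 by (intro binomial_le_power_mult) auto
  also have "\<dots> \<le> exp (- g * real s / 4) * real ((n - q) choose r)"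
  proof (rule mult_right_mono)
    have "(1 - g / 2) ^ r \<le> exp (- g / 2) ^ r"
      using g1 exp_ge_add_one_self[of "- g / 2"] by (intro power_mono) auto
    also have "\<dots> = exp (- (g / 2 * real r))" by (simp add: exp_of_nat_mult[symmetric] mult.commute)
    also have "\<dots> \<le> exp (- g * real s / 4)"
    proof -
      have "real s / 2 \<le> real r" using F(2) by (simp add: r_def q_def)
      then have "g / 2 * (real s / 2) \<le> g / 2 * real r" using g by (intro mult_left_mono) auto
      then show ?thesis by simp
    qed
    finally show "(1 - g / 2) ^ r \<le> exp (- g * real s / 4)" .
  qed simp
  finally show ?thesis using lhs rhs by simp
qed

text \<open>Double counting: a set of size \<open>s\<close> contains the images of exactly
  \<open>s ^ card J\<close> maps. The union bound thus pays \<open>s ^ (k * t)\<close> and not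
  \<open>n ^ (k * t)\<close> for the fingerprints, which keeps the sample size free of
  \<open>n\<close>.\<close>

lemma sum_card_nsets_containing_image:
  fixes n s :: nat
  assumes J: "finite J"
  shows "(\<Sum>x\<in>J \<rightarrow>\<^sub>E {..<n}. card {S \<in> nsets {..<n} s. x ` J \<subseteq> S}) = card (nsets {..<n} s) * s ^ card J"
proof -
  have fin: "finite (J \<rightarrow>\<^sub>E {..<n})" "finite (nsets {..<n::nat} s)"
    using J by (auto intro: finite_PiE finite_imp_finite_nsets)
  have "(\<Sum>x\<in>J \<rightarrow>\<^sub>E {..<n}. card {S \<in> nsets {..<n} s. x ` J \<subseteq> S}) =
      (\<Sum>S\<in>nsets {..<n} s. card {x \<in> J \<rightarrow>\<^sub>E {..<n}. x ` J \<subseteq> S})"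
    using fin by (rule sum_multicount_gen) simp
  also have "\<dots> = (\<Sum>S\<in>nsets {..<n} s. s ^ card J)"
  proof (rule sum.cong)
    fix S assume S: "S \<in> nsets {..<n} s"
    then have "{x \<in> J \<rightarrow>\<^sub>E {..<n}. x ` J \<subseteq> S} = J \<rightarrow>\<^sub>E S"
      by (auto simp: nsets_def PiE_def Pi_def)
    then show "card {x \<in> J \<rightarrow>\<^sub>E {..<n}. x ` J \<subseteq> S} = s ^ card J"
      using S J by (simp add: card_PiE nsets_def)
  qed simp
  finally show ?thesis by simp
qed

lemma sum_power_le_of_le_half:
  fixes \<rho> \<delta> :: real
  assumes "0 \<le> \<rho>" "\<rho> \<le> \<delta> / 2" "\<delta> \<le> 1"
  shows "(\<Sum>t\<in>{1..T}. \<rho> ^ t) \<le> \<delta>"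
proof -
  \<comment> \<open>The subtracted remainder is what makes the induction go through.\<close>
  have "(\<Sum>t\<in>{1..T}. \<rho> ^ t) \<le> \<delta> * (1 - (1/2) ^ T)"
  proof (induction T)
    case (Suc T)
    have "\<rho> ^ T \<le> (1/2) ^ T" using assms by (intro power_mono) auto
    then have "\<rho> ^ Suc T \<le> \<delta> / 2 * (1/2) ^ T" using assms by (simp only: power_Suc) (intro mult_mono, auto)
    then show ?case using Suc by (simp add: algebra_simps)
  qed simp
  also have "\<dots> \<le> \<delta>" using assms by (intro mult_right_le_one_le) (auto simp: power_le_one)
  finally show ?thesis .
qed

text \<open>For fixed \<open>t\<close> the fingerprints contribute \<open>s ^ (k * t)\<close> and
  each has failure rate exp(-\<gamma> t s / 4). The product is the \<open>t\<close>-th power of one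
  number, so the union bound over \<open>t\<close> is a geometric series.\<close>

lemma card_colorable_samples_le:
  fixes \<gamma> \<delta> :: real
  assumes G: "G \<in> graphs_on n" and n: "n \<ge> 1" and far: "eps_far (k_Colorable k) n \<epsilon> G"
    and k: "k \<ge> 1" and T: "1 / real (Suc T) < \<epsilon> / 2" and \<gamma>: "\<gamma> * ln (real (Suc T)) \<le> \<epsilon> / 2" "0 \<le> \<gamma>"
    and s: "s \<ge> 1" "2 * k * T \<le> s" and kn: "real k \<le> \<gamma> / 2 * real n"
    and \<delta>: "real s ^ k * exp (- \<gamma> * real s / 4) \<le> \<delta> / 2" "\<delta> \<le> 1"
  shows "real (card {S \<in> nsets {..<n} s. colorable k (induced G S)}) \<le> \<delta> * real (card (nsets {..<n} s))"
proof -
  define V where "V = {..<n}"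
  define J where "J = (\<lambda>t :: nat. {..<k} \<times> {..<t})"
  define C where "C = (\<lambda>(x :: nat \<times> nat \<Rightarrow> nat) t. \<Union>i<k. container G (\<lambda>j. x (i, j)) t)"
  \<comment> \<open>Extensional maps keep the set of candidate fingerprints finite; only those whose
    containers miss enough vertices are retained.\<close>
  define X where "X = (\<lambda>t. {x \<in> J t \<rightarrow>\<^sub>E V. \<gamma> * real t * real n \<le> real (card (V - C x t))})"
  define B where "B = (\<lambda>t x. {S \<in> nsets V s. x ` J t \<subseteq> S \<and> S \<subseteq> x ` J t \<union> C x t})"
  define \<rho> where "\<rho> = real s ^ k * exp (- \<gamma> * real s / 4)"
  have finJ: "finite (J t)" and cardJ: "card (J t) = k * t" for t by (auto simp: J_def)
  have finE: "finite (J t \<rightarrow>\<^sub>E V)" for t using finJ by (auto simp: V_def intro: finite_PiE)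
  then have finX: "finite (X t)" for t by (simp add: X_def)
  have finB: "finite (B t x)" for t x by (simp add: B_def V_def finite_imp_finite_nsets)
  have "{S \<in> nsets V s. colorable k (induced G S)} \<subseteq> (\<Union>t\<in>{1..T}. \<Union>x\<in>X t. B t x)"
  proof clarify
    fix S assume S: "S \<in> nsets V s" and col: "colorable k (induced G S)"
    then have SV: "S \<subseteq> {..<n}" "S \<noteq> {}" using s(1) by (auto simp: nsets_def V_def)
    obtain x where x: "range x \<subseteq> S" "\<And>t. S \<subseteq> x ` J t \<union> C x t"
      using colorable_fingerprints_exist[OF G SV col] unfolding J_def C_def by blast
    obtain t where t: "t \<in> {1..T}" "\<gamma> * real t * real n \<le> real (card (V - C x t))"
      using far_imp_containers_miss_many[OF G n far k T \<gamma>, of "\<lambda>i j. x (i, j)"]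
      by (auto simp: C_def V_def)
    \<comment> \<open>Up to index \<open>t\<close> the containers read only the values on
      \<open>J t\<close>, so truncating the fingerprint changes neither them nor its image.\<close>
    define y where "y = restrict x (J t)"
    have "C y t = C x t"
      unfolding C_def
      by (intro SUP_cong refl container_cong) (auto simp: y_def J_def)
    moreover have "y ` J t = x ` J t" by (auto simp: y_def)
    moreover have "y \<in> J t \<rightarrow>\<^sub>E V" using x(1) SV(1) by (auto simp: y_def V_def)
    moreover have "x ` J t \<subseteq> S" using x(1) by auto
    ultimately have "y \<in> X t" "S \<in> B t y"
      using t(2) x(2)[of t] S by (auto simp: X_def B_def)
    then show "S \<in> (\<Union>t\<in>{1..T}. \<Union>x\<in>X t. B t x)" using t(1) by blast
  qed
  then have "card {S \<in> nsets V s. colorable k (induced G S)} \<le> card (\<Union>t\<in>{1..T}. \<Union>x\<in>X t. B t x)"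
    using finX finB by (intro card_mono) auto
  also have "\<dots> \<le> (\<Sum>t\<in>{1..T}. card (\<Union>x\<in>X t. B t x))" by (rule card_UN_le) simp
  also have "\<dots> \<le> (\<Sum>t\<in>{1..T}. \<Sum>x\<in>X t. card (B t x))"
    using finX by (intro sum_mono card_UN_le)
  finally have "real (card {S \<in> nsets V s. colorable k (induced G S)})
      \<le> (\<Sum>t\<in>{1..T}. \<Sum>x\<in>X t. real (card (B t x)))"
    by (simp only: of_nat_sum[symmetric] of_nat_le_iff)
  also have "\<dots> \<le> (\<Sum>t\<in>{1..T}. \<rho> ^ t * real (card (nsets V s)))"
  proof (rule sum_mono)
    fix t assume t: "t \<in> {1..T}"
    have "real (card (B t x)) \<le> exp (- (\<gamma> * real t) * real s / 4) * real (card {S \<in> nsets V s. x ` J t \<subseteq> S})"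
      if x: "x \<in> X t" for x
      unfolding B_def V_def
    proof (rule card_nsets_between_le)
      have "card (x ` J t) \<le> k * t" using card_image_le[OF finJ] cardJ by metis
      then have c: "card (x ` J t) \<le> k * t" "k * t \<le> k * T" using t by auto
      then show "2 * card (x ` J t) \<le> s" using s(2) by linarith
      have "real (card (x ` J t)) \<le> real k * real t" using c(1) by (metis of_nat_le_iff of_nat_mult)
      also have "\<dots> \<le> (\<gamma> / 2 * real n) * real t" using kn by (intro mult_right_mono) auto
      finally show "real (card (x ` J t)) \<le> \<gamma> * real t / 2 * real n" by (simp add: mult_ac)
      show "C x t \<subseteq> {..<n}"
        using container_subset_verts[of G] G by (fastforce simp: C_def graphs_on_def)
    qed (use x n \<gamma> in \<open>auto simp: X_def V_def\<close>)
    then have "(\<Sum>x\<in>X t. real (card (B t x)))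
        \<le> (\<Sum>x\<in>X t. exp (- (\<gamma> * real t) * real s / 4) * real (card {S \<in> nsets V s. x ` J t \<subseteq> S}))"
      by (rule sum_mono)
    \<comment> \<open>The sum is enlarged to all maps so that double counting applies.\<close>
    also have "\<dots> \<le> (\<Sum>x\<in>J t \<rightarrow>\<^sub>E V. exp (- (\<gamma> * real t) * real s / 4) * real (card {S \<in> nsets V s. x ` J t \<subseteq> S}))"
      using finE by (intro sum_mono2) (auto simp: X_def)
    also have "\<dots> = exp (- (\<gamma> * real t) * real s / 4) * real (card (nsets V s) * s ^ card (J t))"
      using sum_card_nsets_containing_image[OF finJ[of t], of n s]
      by (simp only: sum_distrib_left[symmetric] of_nat_sum[symmetric] V_def)
    also have "\<dots> = \<rho> ^ t * real (card (nsets V s))"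
    proof -
      have "exp (- \<gamma> * real s / 4) ^ t = exp (- (\<gamma> * real t) * real s / 4)"
        by (simp add: exp_of_nat_mult[symmetric] mult_ac)
      then show ?thesis by (simp add: \<rho>_def cardJ power_mult_distrib power_mult)
    qed
    finally show "(\<Sum>x\<in>X t. real (card (B t x))) \<le> \<rho> ^ t * real (card (nsets V s))" .
  qed
  also have "\<dots> = (\<Sum>t\<in>{1..T}. \<rho> ^ t) * real (card (nsets V s))" by (simp only: sum_distrib_right)
  also have "\<dots> \<le> \<delta> * real (card (nsets V s))"
    using \<delta> by (intro mult_right_mono sum_power_le_of_le_half) (auto simp: \<rho>_def)
  finally show ?thesis by (simp add: V_def)
qed

section \<open>From counting to testers, and the two trivial regimes\<close>

lemma accept_prob_return:
  assumes "s \<le> n"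
  shows "accept_prob (\<lambda>H. return_pmf (P H)) n s G =
    real (card {S \<in> nsets {..<n} s. P (induced G S)}) / real (card (nsets {..<n} s))"
proof -
  have fin: "finite (nsets {..<n} s)" by (simp add: finite_imp_finite_nsets)
  have "card (nsets {..<n} s) = n choose s" by simp
  \<comment> \<open>\<open>pmf_of_set\<close> has its intended meaning only on a finite nonempty
    set, which is where s \<le> n enters.\<close>
  then have ne: "nsets {..<n} s \<noteq> {}" using assms
    by (metis card.empty card_lessThan binomial_eq_0_iff not_less)
  have "accept_prob (\<lambda>H. return_pmf (P H)) n s G =
      pmf (map_pmf (\<lambda>S. P (induced G S)) (pmf_of_set (nsets {..<n} s))) True"
    by (simp add: accept_prob_def map_pmf_def)
  also have "\<dots> = measure (pmf_of_set (nsets {..<n} s)) {S. P (induced G S)}"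
    by (simp add: pmf_map vimage_def)
  also have "\<dots> = real (card (nsets {..<n} s \<inter> {S. P (induced G S)})) / real (card (nsets {..<n} s))"
    using fin ne by (simp add: measure_pmf_of_set)
  finally show ?thesis by (simp add: Int_def)
qed

lemma colorable_induced:
  assumes "G \<in> k_Colorable k n" "S \<subseteq> {..<n}"
  shows "colorable k (induced G S)"
proof -
  obtain f where "f \<in> {..<n} \<rightarrow> {..<k}" "\<forall>u v. {u, v} \<in> edges G \<longrightarrow> f u \<noteq> f v"
    using assms(1) by (auto simp: k_Colorable_def graphs_on_def colorable_def)
  then show ?thesis
    unfolding colorable_def induced_def using assms(2) by (intro exI[of _ f]) auto
qed

lemma accept_prob_colorable:
  assumes "s \<le> n" "G \<in> k_Colorable k n"
  shows "accept_prob (\<lambda>H. return_pmf (colorable k H)) n s G = 1"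
proof -
  have "{S \<in> nsets {..<n} s. colorable k (induced G S)} = nsets {..<n} s"
    using colorable_induced[OF assms(2)] by (auto simp: nsets_def)
  then show ?thesis using assms(1) by (simp add: accept_prob_return)
qed

lemma sample_complexity_le:
  "canonical_tester \<delta>\<^sub>1 \<delta>\<^sub>2 P n \<epsilon> s A \<Longrightarrow> sample_complexity \<delta>\<^sub>1 \<delta>\<^sub>2 P n \<epsilon> \<le> s"
  unfolding sample_complexity_def by (intro Least_le) blast

text \<open>The tester accepts exactly when the sample is \<open>k\<close>-colourable. Its error is
  one-sided, so only the far graphs need a bound.\<close>

lemma sample_complexity_k_Colorable_le:
  assumes "s \<le> n" "\<delta>\<^sub>1 \<le> 1"
    and "\<And>G. G \<in> graphs_on n \<Longrightarrow> eps_far (k_Colorable k) n \<epsilon> G \<Longrightarrow>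
      real (card {S \<in> nsets {..<n} s. colorable k (induced G S)}) \<le> \<delta>\<^sub>2 * real (card (nsets {..<n} s))"
  shows "sample_complexity \<delta>\<^sub>1 \<delta>\<^sub>2 (k_Colorable k) n \<epsilon> \<le> s"
proof (rule sample_complexity_le)
  have "card (nsets {..<n} s) > 0" using assms(1) by simp
  then show "canonical_tester \<delta>\<^sub>1 \<delta>\<^sub>2 (k_Colorable k) n \<epsilon> s (\<lambda>H. return_pmf (colorable k H))"
    unfolding canonical_tester_def
    using assms by (simp add: accept_prob_colorable)
      (simp add: accept_prob_return divide_le_eq)
qed

text \<open>Reading the whole graph always works; this covers the case where the target bound
  reaches \<open>n\<close>.\<close>

lemma sample_complexity_k_Colorable_le_n:
  assumes "n \<ge> 1" "\<epsilon> > 0" "0 < \<delta>\<^sub>2" "\<delta>\<^sub>1 \<le> 1"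
  shows "sample_complexity \<delta>\<^sub>1 \<delta>\<^sub>2 (k_Colorable k) n \<epsilon> \<le> n"
proof (rule sample_complexity_k_Colorable_le)
  fix G assume G: "G \<in> graphs_on n" and far: "eps_far (k_Colorable k) n \<epsilon> G"
  have "0 < \<epsilon> * (real n)\<^sup>2" using assms by simp
  then have "\<not> colorable k G" using far G by (fastforce simp: eps_far_def k_Colorable_def)
  moreover have "induced G S = G" if "S \<in> nsets {..<n} n" for S
  proof -
    have "S = {..<n}" using that card_subset_eq[of "{..<n}" S] by (auto simp: nsets_def)
    moreover have "e \<subseteq> {..<n}" if "e \<in> edges G" for e
      using G that by (auto simp: graphs_on_def nsets_def)
    ultimately show ?thesis
      using G by (cases G) (auto simp: induced_def graphs_on_def)
  qed
  ultimately have "{S \<in> nsets {..<n} n. colorable k (induced G S)} = {}" by auto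
  then show "real (card {S \<in> nsets {..<n} n. colorable k (induced G S)}) \<le> \<delta>\<^sub>2 * real (card (nsets {..<n} n))"
    using assms(3) by (simp only: card.empty of_nat_0 card_nsets) simp
qed (use assms in auto)

text \<open>Colouring by residues modulo \<open>k\<close> leaves at most n(n-1)/(2k) monochromatic
  edges. For such \<epsilon> no graph is far and an empty sample suffices, which matters since the
  target bound vanishes at \<epsilon> = 1.\<close>

lemma not_eps_far_if_eps_large:
  assumes G: "G \<in> graphs_on n" and "n \<ge> 1" "k \<ge> 1" "\<epsilon> \<ge> 1 / (2 * real k)"
  shows "\<not> eps_far (k_Colorable k) n \<epsilon> G"
proof
  assume far: "eps_far (k_Colorable k) n \<epsilon> G"
  define M where "M = {e \<in> edges G. \<exists>u v. e = {u, v} \<and> u mod k = v mod k}"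
  \<comment> \<open>The smaller vertices in the residue class of \<open>v\<close> are
    \<open>v mod k + k * q\<close> for \<open>q < v div k\<close>.\<close>
  have sub: "M \<subseteq> (\<Union>v<n. (\<lambda>q. {v mod k + k * q, v}) ` {..<v div k})"
  proof
    fix e assume "e \<in> M"
    then obtain u v where e: "e = {u, v}" "{u, v} \<in> edges G" "u mod k = v mod k" by (auto simp: M_def)
    have *: "e \<in> (\<Union>v<n. (\<lambda>q. {v mod k + k * q, v}) ` {..<v div k})"
      if "e = {u, v}" "u < v" "v < n" "u mod k = v mod k" for u v
    proof -
      have u: "u = v mod k + k * (u div k)" using that(4) mod_mult_div_eq[of u k] by simp
      have "u div k \<noteq> v div k" using u that(2) mod_mult_div_eq[of v k] by auto
      moreover have "u div k \<le> v div k" using that(2) by (intro div_le_mono) simp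
      ultimately have "u div k < v div k" by simp
      moreover have "e = {v mod k + k * (u div k), v}" unfolding u[symmetric] by (fact that(1))
      ultimately have "e \<in> (\<lambda>q. {v mod k + k * q, v}) ` {..<v div k}" by blast
      then show ?thesis using that(3) by blast
    qed
    show "e \<in> (\<Union>v<n. (\<lambda>q. {v mod k + k * q, v}) ` {..<v div k})"
    proof (cases "u < v")
      case True
      then show ?thesis using *[of u v] e edge_in_graphs_on[OF G e(2)] by simp
    next
      case False
      then show ?thesis using *[of v u] e edge_in_graphs_on[OF G e(2)] by (simp add: insert_commute)
    qed
  qed
  have "card M \<le> card (\<Union>v<n. (\<lambda>q. {v mod k + k * q, v}) ` {..<v div k})"
    by (intro card_mono sub) auto
  also have "\<dots> \<le> (\<Sum>v<n. card ((\<lambda>q. {v mod k + k * q, v}) ` {..<v div k}))" by (rule card_UN_le) simp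
  also have "\<dots> \<le> (\<Sum>v<n. v div k)" by (intro sum_mono order.trans[OF card_image_le]) auto
  finally have "real (card M) \<le> (\<Sum>v<n. real (v div k))" by (simp only: of_nat_sum[symmetric] of_nat_le_iff)
  also have "\<dots> \<le> (\<Sum>v<n. real v / real k)" by (intro sum_mono of_nat_div_le_of_nat)
  also have "\<dots> = (\<Sum>v<n. real v) / real k" by (simp only: sum_divide_distrib)
  also have "(\<Sum>v<n. real v) = real n * (real n - 1) / 2"
    by (induction n) (auto simp: algebra_simps add_divide_distrib)
  also have "real n * (real n - 1) / 2 / real k < 1 / (2 * real k) * (real n)\<^sup>2"
    using assms by (simp add: field_simps power2_eq_square)
  also have "\<dots> \<le> \<epsilon> * (real n)\<^sup>2" using assms by (intro mult_right_mono) auto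
  also have "\<dots> \<le> real (card M)"
    unfolding M_def using assms by (intro eps_far_imp_many_monochromatic[OF G far]) auto
  finally show False by simp
qed

section \<open>Choice of the constants and the final case split\<close>

lemma exists_ln_le_linear: "\<exists>c::real \<ge> 48. 2 * ln c + K \<le> c / 48"
proof -
  \<comment> \<open>Of the allowance c/48, one half absorbs 2 ln (c/192) \<le> c/96 and the other
    half the constants.\<close>
  define c where "c = max 48 (96 * (2 * ln 192 + K))"
  have "c > 0" by (simp add: c_def)
  then have "ln c = ln (c / 192) + ln 192" by (simp add: ln_div)
  also have "ln (c / 192) \<le> c / 192" using \<open>c > 0\<close> ln_le_minus_one[of "c / 192"] by simp
  finally have "2 * ln c \<le> c / 96 + 2 * ln 192" by simp
  moreover have "2 * ln 192 + K \<le> c / 96" by (simp add: c_def)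
  ultimately have "2 * ln c + K \<le> c / 48" by simp
  then show ?thesis by (intro exI[of _ c]) (simp add: c_def)
qed

lemma sample_complexity_k_Colorable_le_floor:
  fixes c \<epsilon> \<delta>\<^sub>1 \<delta>\<^sub>2 :: real
  assumes \<delta>: "0 < \<delta>\<^sub>2" "\<delta>\<^sub>2 < \<delta>\<^sub>1" "\<delta>\<^sub>1 \<le> 1" and nk: "n \<ge> 1" "k \<ge> 1"
    and \<epsilon>: "0 < \<epsilon>" "\<epsilon> < 1 / (2 * real k)"
    and c: "c \<ge> 48" "2 * ln c + (4 + 2 * ln (2 / \<delta>\<^sub>2)) \<le> c / 48"
    and Y: "Y = c * (real k / \<epsilon>) * (ln (1 / \<epsilon>))\<^sup>2" "Y < real n"
  shows "sample_complexity \<delta>\<^sub>1 \<delta>\<^sub>2 (k_Colorable k) n \<epsilon> \<le> nat \<lfloor>Y\<rfloor>"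
proof -
  define e where "e = 1 / \<epsilon>"
  define L where "L = ln e"
  define s where "s = nat \<lfloor>Y\<rfloor>"
  \<comment> \<open>\<open>T\<close> is about 2/\<epsilon>, so 1/(T+1) < \<epsilon>/2. Since T + 1
    \<le> e^3, ln (T+1) \<le> 3 L, and \<gamma> is chosen so that 3 L \<gamma> =
    \<epsilon>/2.\<close>
  define T where "T = nat \<lceil>2 * e\<rceil>"
  define \<gamma> where "\<gamma> = \<epsilon> / (6 * L)"
  have e_gt: "e > 2 * real k" using \<epsilon> nk by (simp add: e_def field_simps)
  then have e2: "e > 2" using nk by simp
  have "ln (1/2 :: real) \<le> 1/2 - 1" by (rule ln_le_minus_one) simp
  then have "1/2 \<le> ln (2 :: real)" by (simp add: ln_div)
  also have "ln 2 \<le> L" using e2 by (simp add: L_def)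
  \<comment> \<open>This absolute lower bound lets constant terms be absorbed into multiples of
    \<open>L\<close>.\<close>
  finally have L: "1/2 \<le> L" .
  have L_le: "L \<le> e" using ln_le_minus_one[of e] e2 by (simp add: L_def)
  have k1: "1 \<le> real k" using nk by simp
  have Ye: "Y = c * (real k * e) * L\<^sup>2" by (simp add: Y(1) e_def L_def)
  have ke: "2 \<le> real k * e" using mult_mono[of 1 "real k" 2 e] k1 e2 by simp
  have L2: "1/2 * L \<le> L\<^sup>2" "1/4 \<le> L\<^sup>2"
  proof -
    show *: "1/2 * L \<le> L\<^sup>2" unfolding power2_eq_square using L by (intro mult_right_mono) auto
    then show "1/4 \<le> L\<^sup>2" using L by linarith
  qed
  have Y_ge: "c * (real k * e) * (1/4) \<le> Y" "c * (real k * e) * (1/2 * L) \<le> Y"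
    unfolding Ye using L2 c(1) ke e2 by (intro mult_left_mono mult_nonneg_nonneg; simp)+
  have cke: "48 * (real k * e) \<le> c * (real k * e)" using c ke by (intro mult_right_mono) auto
  have Y2: "2 \<le> Y" using Y_ge(1) cke ke by linarith
  have s_le: "real s \<le> Y" and s_ge: "Y / 2 \<le> real s" using Y2 unfolding s_def by linarith+
  have T: "2 * e \<le> real T" "real T \<le> 2 * e + 1" using e2 unfolding T_def by linarith+
  have "sample_complexity \<delta>\<^sub>1 \<delta>\<^sub>2 (k_Colorable k) n \<epsilon> \<le> s"
  proof (rule sample_complexity_k_Colorable_le)
    show "s \<le> n" using s_le Y(2) by linarith
    show "\<delta>\<^sub>1 \<le> 1" by fact
    fix G assume G: "G \<in> graphs_on n" and far: "eps_far (k_Colorable k) n \<epsilon> G"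
    show "real (card {S \<in> nsets {..<n} s. colorable k (induced G S)}) \<le> \<delta>\<^sub>2 * real (card (nsets {..<n} s))"
    proof (rule card_colorable_samples_le[OF G nk(1) far nk(2)])
      have "2 / \<epsilon> < real (Suc T)" using T by (simp add: e_def)
      then show "1 / real (Suc T) < \<epsilon> / 2" using \<epsilon> by (simp add: field_simps)
      have "real (Suc T) \<le> 4 * e" using T e2 by simp
      also have "\<dots> \<le> e ^ 2 * e"
      proof (rule mult_right_mono)
        show "4 \<le> e ^ 2" using power_mono[of 2 e 2] e2 by simp
      qed (use e2 in simp)
      also have "\<dots> = e ^ 3" by (simp add: power2_eq_square power3_eq_cube)
      finally have "ln (real (Suc T)) \<le> ln (e ^ 3)" using e2 by (subst ln_le_cancel_iff) auto
      also have "\<dots> = 3 * L" using e2 by (simp add: ln_realpow L_def)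
      finally have "\<gamma> * ln (real (Suc T)) \<le> \<gamma> * (3 * L)"
        using \<epsilon> L by (intro mult_left_mono) (auto simp: \<gamma>_def)
      then show "\<gamma> * ln (real (Suc T)) \<le> \<epsilon> / 2" using L by (simp add: \<gamma>_def)
      show "0 \<le> \<gamma>" using \<epsilon> L by (simp add: \<gamma>_def)
      show "1 \<le> s" using s_ge Y2 by linarith
      have "real k * real T \<le> real k * (3 * e)" using T e2 by (intro mult_left_mono) auto
      then have "2 * (real k * real T) \<le> real s" using Y_ge(1) cke s_ge by linarith
      then have "real (2 * k * T) \<le> real s" by simp
      then show "2 * k * T \<le> s" by (simp only: of_nat_le_iff)
      have "48 * (real k * e) * L \<le> c * (real k * e) * L" using L by (intro mult_right_mono[OF cke]) auto
      then have "12 * (real k * e) * L \<le> real n" using Y_ge(2) Y(2) ke L by simp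
      then show "real k \<le> \<gamma> / 2 * real n" using \<epsilon> L by (simp add: \<gamma>_def e_def field_simps)
      show "real s ^ k * exp (- \<gamma> * real s / 4) \<le> \<delta>\<^sub>2 / 2"
      proof -
        define M where "M = ln (2 / \<delta>\<^sub>2)"
        have M0: "0 \<le> M" using \<delta> by (simp add: M_def)
        have s0: "0 < real s" using s_ge Y2 by linarith
        \<comment> \<open>Both \<open>k\<close> and \<open>L\<close> are at most \<open>e\<close>,
          so ln s \<le> ln c + 4 L.\<close>
        have "Y \<le> c * (e * e) * e\<^sup>2"
          unfolding Ye using c e_gt k1 e2 L L_le by (intro mult_mono power_mono) auto
        also have "\<dots> = c * e ^ 4" by (simp add: power2_eq_square power4_eq_xxxx)
        finally have "ln (real s) \<le> ln (c * e ^ 4)" using s_le s0 by (subst ln_le_cancel_iff) auto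
        also have "\<dots> = ln c + 4 * L" using c e2 by (simp add: ln_mult ln_realpow L_def)
        finally have ln_s: "real k * ln (real s) \<le> real k * (ln c + 4 * L)" by (intro mult_left_mono) auto
        have kL: "1 / 2 \<le> real k * L" using mult_mono[of 1 "real k" "1/2" L] k1 L by simp
        have "real k * ln c + M \<le> 2 * (real k * L) * ln c + 2 * (real k * L) * M"
        proof (rule add_mono)
          have "1 * ln c \<le> 2 * L * ln c" using L c by (intro mult_right_mono) auto
          then show "real k * ln c \<le> 2 * (real k * L) * ln c"
            using k1 mult_left_mono[of "ln c" "2 * L * ln c" "real k"] by (simp add: mult_ac)
          have "1 * M \<le> 2 * (real k * L) * M" using kL M0 by (intro mult_right_mono) auto
          then show "M \<le> 2 * (real k * L) * M" by simp
        qed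
        then have "real k * (ln c + 4 * L) + M \<le> (real k * L) * (2 * ln c + (4 + 2 * M))"
          by (simp add: algebra_simps)
        also have "\<dots> \<le> (real k * L) * (c / 48)" using c(2) kL by (intro mult_left_mono) (auto simp: M_def)
        \<comment> \<open>Here the squared logarithm is spent: \<gamma> cancels one factor
          \<open>L\<close>, and the other dominates ln s. The 48 is 6 from \<gamma>, 2 from rounding
          \<open>Y\<close> down, and 4 from the exponent.\<close>
        also have "\<dots> = \<gamma> * (Y / 2) / 4"
          using L \<epsilon> by (simp add: \<gamma>_def Ye e_def power2_eq_square)
        also have "\<dots> \<le> \<gamma> * real s / 4"
          using s_ge \<epsilon> L by (intro divide_right_mono mult_left_mono) (auto simp: \<gamma>_def)
        finally have "real k * ln (real s) - \<gamma> * real s / 4 \<le> - M" using ln_s by linarith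
        moreover have "real s ^ k = exp (real k * ln (real s))" using s0 by (simp add: exp_of_nat_mult)
        ultimately have "real s ^ k * exp (- \<gamma> * real s / 4) \<le> exp (- M)"
          by (simp add: exp_add[symmetric])
        also have "exp (- M) = \<delta>\<^sub>2 / 2" using \<delta> by (simp add: M_def exp_minus)
        finally show ?thesis .
      qed
      show "\<delta>\<^sub>2 \<le> 1" using \<delta> by simp
    qed
  qed
  then show ?thesis by (simp add: s_def)
qed

theorem theorem2:
  fixes \<delta>\<^sub>1 \<delta>\<^sub>2 :: real
  assumes "0 < \<delta>\<^sub>2" and "\<delta>\<^sub>2 < \<delta>\<^sub>1" and "\<delta>\<^sub>1 \<le> 1"
  shows "\<exists>c::real. c > 0 \<and>
    (\<forall>(n::nat) (k::nat) (\<epsilon>::real). n \<ge> 1 \<longrightarrow> k \<ge> 1 \<longrightarrow> \<epsilon> > 0 \<longrightarrow>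
       real (sample_complexity \<delta>\<^sub>1 \<delta>\<^sub>2 (k_Colorable k) n \<epsilon>)
         \<le> c * (real k / \<epsilon>) * (ln (1 / \<epsilon>))\<^sup>2)"
proof -
  obtain c :: real where c: "c \<ge> 48" "2 * ln c + (4 + 2 * ln (2 / \<delta>\<^sub>2)) \<le> c / 48"
    using exists_ln_le_linear by blast
  have "real (sample_complexity \<delta>\<^sub>1 \<delta>\<^sub>2 (k_Colorable k) n \<epsilon>) \<le> c * (real k / \<epsilon>) * (ln (1 / \<epsilon>))\<^sup>2"
    if nk: "n \<ge> 1" "k \<ge> 1" and \<epsilon>: "\<epsilon> > 0" for n k :: nat and \<epsilon> :: real
  proof -
    define Y where "Y = c * (real k / \<epsilon>) * (ln (1 / \<epsilon>))\<^sup>2"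
    have Y0: "0 \<le> Y" using c \<epsilon> by (simp add: Y_def)
    \<comment> \<open>In turn: no graph is far, the whole graph may be read, or the container bound
      applies with a sample size below \<open>n\<close>.\<close>
    consider "\<epsilon> \<ge> 1 / (2 * real k)" | "real n \<le> Y" | "\<epsilon> < 1 / (2 * real k)" "Y < real n"
      by linarith
    then have "real (sample_complexity \<delta>\<^sub>1 \<delta>\<^sub>2 (k_Colorable k) n \<epsilon>) \<le> Y"
    proof cases
      case 1
      then have "sample_complexity \<delta>\<^sub>1 \<delta>\<^sub>2 (k_Colorable k) n \<epsilon> \<le> 0"
        using not_eps_far_if_eps_large nk assms(3) by (intro sample_complexity_k_Colorable_le) blast+
      then show ?thesis using Y0 by simp
    next
      case 2
      then show ?thesis
        using sample_complexity_k_Colorable_le_n[OF nk(1) \<epsilon> assms(1,3), of k] by linarith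
    next
      case 3
      then show ?thesis
        using sample_complexity_k_Colorable_le_floor[OF assms nk \<epsilon> 3(1) c Y_def 3(2)] Y0 by linarith
    qed
    then show ?thesis by (simp add: Y_def)
  qed
  then show ?thesis using c by (intro exI[of _ c]) auto
qed

end
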